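(* Let $\mathtt r\le \mathtt r_0$ and suppose that the following two conditions hold for this $\mathtt r$. (i) There is a constant $\omega(\mathtt r)\in[0,1/2]$ such that for all $\theta\in\Theta_0(\mathtt r)$ and all $|\lambda|\le \mathtt g$, $$\sup_{\gamma\in\mathbb R^p\setminus\{0\}}\log \mathbb E\exp\Big\{\lambda\,\frac{\gamma^\top\{\nabla\zeta(\theta)-\nabla\zeta(\theta^* )\}}{\omega(\mathtt r)\,\|V_0\gamma\|}\Big\}\le \frac{\nu_0^2\lambda^2}{2}.$$ (ii) There are a symmetric strictly positive-definite matrix $D_0^2$ and a constant $\delta(\mathtt r)\in[0,1/2]$ such that for all $\theta\in\Theta_0(\mathtt r)$, $\theta\neq\theta^*$, $$\Big|\frac{-2\,\mathbb E L(\theta,\theta^* )}{\|D_0(\theta-\theta^* )\|^2}-1\Big|\le\delta(\mathtt r).$$ Let $\varrho\ge 3\nu_0\,\omega(\mathtt r)$ and $\delta\ge\delta(\mathtt r)$ be such that $D_\epsilon^2=D_0^2(1-\delta)-\varrho V_0^2$ is positive definite, $\epsilon=(\delta,\varrho)$, $\underline\epsilon=-\epsilon$. Let $$C_\epsilon(\mathtt r)=\{\tilde\theta\in\Theta_0(\mathtt r),\ \|V_0D_{\underline\epsilon}^{-1}\xi_{\underline\epsilon}\|\le\mathtt r\}.$$ Then for every $u>0$ $$\mathbb E\big\{L^{u}(\tilde\theta,\theta^* )\,\mathbf 1(\tilde\theta\in\Theta_0(\mathtt r))\big\}\le\mathbb E\Big[\big\{\|\xi_\epsilon\|^2/2+\Diamond_\epsilon(\mathtt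 r)\big\}^{u}\Big],$$ and moreover $$\mathbb E\big\{\|D_\epsilon(\tilde\theta-\theta^* )\|^{u}\,\mathbf 1(C_\epsilon(\mathtt r))\big\}\le\mathbb E\Big[\big\{\|\xi_\epsilon\|+\sqrt{2\Delta_\epsilon(\mathtt r)}\big\}^{u}\Big].$$
   Context: Setting. $\Theta\subseteq\mathbb R^p$. The data $Y$ have a distribution $\mathbb P$ with expectation $\mathbb E$. $L(\theta)=L(Y,\theta)$, $\theta\in\Theta$, is a random function (a quasi log-likelihood; $\mathbb P$ need not belong to any parametric family). Put $L(\theta,\theta')=L(\theta)-L(\theta')$; $L^u(\theta,\theta')$ denotes the $u$-th power of $L(\theta,\theta')$. The quasi maximum likelihood estimator $\tilde\theta=\arg\max_{\theta\in\Theta}L(\theta)$ is assumed to exist (the maximum is attained; if not unique, $\tilde\theta$ is any maximizer). The target is $\theta^*=\arg\max_{\theta\in\Theta}\mathbb E L(\theta)$, and $\nabla\mathbb E L(\theta^* )=0$. The stochastic component $\zeta(\theta)=L(\theta)-\mathbb E L(\theta)$ is differentiable in $\theta$; thus $\nabla L(\theta^* )=\nabla\zeta(\theta^* )$. $V_0^2$ is a symmetric positive-definite $p\times p$ matrix (with symmetric root $V_0$), $\mathtt g>0$, $\nu_0\ge1$ and $\mathtt r_0>0$ are constants. The local set is $\Theta_0(\mathtt r)=\{\theta:\|V_0(\theta-\theta^* )\|\le \mathtt r\}$, a full ellipsoid contained in $\Theta$ for $\mathtt r\le\mathtt r_0$. When $\omega(\mathtt r)=0$, condition (i) means $\nabla\zeta(\theta)=\nabla\zeta(\theta^*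 )$ on $\Theta_0(\mathtt r)$. $D_{\underline\epsilon}^2=D_0^2(1+\delta)+\varrho V_0^2$; $\xi_\epsilon=D_\epsilon^{-1}\nabla L(\theta^* )$, $\xi_{\underline\epsilon}=D_{\underline\epsilon}^{-1}\nabla L(\theta^* )$ (symmetric positive-definite roots). With $\zeta(\theta,\theta^* )=\zeta(\theta)-\zeta(\theta^* )$, $$\Diamond_{\epsilon}(\mathtt r)=\sup_{\theta\in\Theta_0(\mathtt r)}\Big\{\zeta(\theta,\theta^* )-(\theta-\theta^* )^\top\nabla\zeta(\theta^* )-\tfrac{\varrho}{2}\|V_0(\theta-\theta^* )\|^2\Big\},$$ $$\Diamond_{\underline\epsilon}(\mathtt r)=\sup_{\theta\in\Theta_0(\mathtt r)}\Big\{-\zeta(\theta,\theta^* )+(\theta-\theta^* )^\top\nabla\zeta(\theta^* )-\tfrac{\varrho}{2}\|V_0(\theta-\theta^* )\|^2\Big\}.$$ The spread is $\Delta_\epsilon(\mathtt r)=\Diamond_\epsilon(\mathtt r)+\Diamond_{\underline\epsilon}(\mathtt r)+(\|\xi_\epsilon\|^2-\|\xi_{\underline\epsilon}\|^2)/2$. Expectations of nonnegative variables may be $+\infty$. *)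

theory Defs
  imports "HOL-Probability.Probability"
begin

section \<open>Matrices\<close>

definition sym_posdef :: "real ^ 'p ^ 'p \<Rightarrow> bool" where
  "sym_posdef A \<longleftrightarrow> transpose A = A \<and> (\<forall>x. x \<noteq> 0 \<longrightarrow> 0 < x \<bullet> (A *v x))"

text \<open>The symmetric positive-definite root of a symmetric positive-definite matrix. Below,
  the matrices written \<open>V2\<close>, \<open>D2\<close> are the squared matrices $V_0^2$, $D_0^2$; the matrices
  $V_0$, $D_0$ themselves are recovered as roots.\<close>

definition mat_root :: "real ^ 'p ^ 'p \<Rightarrow> real ^ 'p ^ 'p" where
  "mat_root A = (THE B. sym_posdef B \<and> B ** B = A)"

text \<open>$D_\epsilon^2$ for \<open>\<epsilon> = (\<delta>, \<rho>)\<close>. The matrix $D_{\underline\epsilon}^2$ for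
  $\underline\epsilon = -\epsilon$ is obtained at the arguments \<open>- \<delta>\<close>, \<open>- \<rho>\<close>.\<close>

definition D2_eps :: "real ^ 'p ^ 'p \<Rightarrow> real ^ 'p ^ 'p \<Rightarrow> real \<Rightarrow> real \<Rightarrow> real ^ 'p ^ 'p" where
  "D2_eps D2 V2 \<delta> \<rho> = (1 - \<delta>) *\<^sub>R D2 - \<rho> *\<^sub>R V2"

section \<open>Analytic notions\<close>

text \<open>Gradient relative to \<open>S\<close>. It is the usual gradient at interior points of \<open>S\<close>, and is still
  unique at a boundary point of a full ellipsoid contained in \<open>S\<close>; the local ellipsoid of the
  largest admissible radius may touch the boundary of the parameter set.\<close>

definition grad_within :: "'a::real_inner set \<Rightarrow> ('a \<Rightarrow> real) \<Rightarrow> 'a \<Rightarrow> 'a" where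
  "grad_within S f x = (THE g. (f has_derivative (\<lambda>h. h \<bullet> g)) (at x within S))"

text \<open>Logarithm with values \<open>- \<infinity>\<close> at \<open>0\<close> and \<open>\<infinity>\<close> at \<open>\<infinity>\<close>.\<close>

definition ext_ln :: "ennreal \<Rightarrow> ereal" where
  "ext_ln x = (if x = 0 then - \<infinity> else if x = \<infinity> then \<infinity> else ereal (ln (enn2real x)))"

section \<open>Quasi log-likelihood\<close>

text \<open>The data \<open>y\<close> range over the space of their distribution \<open>P\<close>, and \<open>L y \<theta>\<close> is
  the quasi log-likelihood.\<close>

definition mean_lik :: "'y measure \<Rightarrow> ('y \<Rightarrow> 'a \<Rightarrow> real) \<Rightarrow> 'a \<Rightarrow> real" where
  "mean_lik P L \<theta> = (\<integral>y. L y \<theta> \<partial>P)"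

definition stoch :: "'y measure \<Rightarrow> ('y \<Rightarrow> 'a \<Rightarrow> real) \<Rightarrow> 'y \<Rightarrow> 'a \<Rightarrow> real" where
  "stoch P L y \<theta> = L y \<theta> - mean_lik P L \<theta>"

definition local_set :: "real ^ 'p ^ 'p \<Rightarrow> real ^ 'p \<Rightarrow> real \<Rightarrow> (real ^ 'p) set" where
  "local_set V2 \<theta>s r = {\<theta>. norm (mat_root V2 *v (\<theta> - \<theta>s)) \<le> r}"

text \<open>The score $D^{-1} \nabla L(\theta^*)$, where \<open>A\<close> is $D^2$.\<close>

definition score ::
  "(real ^ 'p) set \<Rightarrow> ('y \<Rightarrow> real ^ 'p \<Rightarrow> real) \<Rightarrow> real ^ 'p \<Rightarrow> real ^ 'p ^ 'p \<Rightarrow> 'y \<Rightarrow> real ^ 'p" where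
  "score \<Theta> L \<theta>s A y = matrix_inv (mat_root A) *v grad_within \<Theta> (L y) \<theta>s"

definition diamond_upper ::
  "'y measure \<Rightarrow> (real ^ 'p) set \<Rightarrow> ('y \<Rightarrow> real ^ 'p \<Rightarrow> real) \<Rightarrow> real ^ 'p \<Rightarrow> real ^ 'p ^ 'p
    \<Rightarrow> real \<Rightarrow> real \<Rightarrow> 'y \<Rightarrow> real" where
  "diamond_upper P \<Theta> L \<theta>s V2 \<rho> r y =
    (SUP \<theta>\<in>local_set V2 \<theta>s r.
      (stoch P L y \<theta> - stoch P L y \<theta>s)
      - (\<theta> - \<theta>s) \<bullet> grad_within \<Theta> (stoch P L y) \<theta>s
      - \<rho> / 2 * (norm (mat_root V2 *v (\<theta> - \<theta>s)))\<^sup>2)"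

definition diamond_lower ::
  "'y measure \<Rightarrow> (real ^ 'p) set \<Rightarrow> ('y \<Rightarrow> real ^ 'p \<Rightarrow> real) \<Rightarrow> real ^ 'p \<Rightarrow> real ^ 'p ^ 'p
    \<Rightarrow> real \<Rightarrow> real \<Rightarrow> 'y \<Rightarrow> real" where
  "diamond_lower P \<Theta> L \<theta>s V2 \<rho> r y =
    (SUP \<theta>\<in>local_set V2 \<theta>s r.
      - (stoch P L y \<theta> - stoch P L y \<theta>s)
      + (\<theta> - \<theta>s) \<bullet> grad_within \<Theta> (stoch P L y) \<theta>s
      - \<rho> / 2 * (norm (mat_root V2 *v (\<theta> - \<theta>s)))\<^sup>2)"

definition spread ::
  "'y measure \<Rightarrow> (real ^ 'p) set \<Rightarrow> ('y \<Rightarrow> real ^ 'p \<Rightarrow> real) \<Rightarrow> real ^ 'p \<Rightarrow> real ^ 'p ^ 'p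
    \<Rightarrow> real ^ 'p ^ 'p \<Rightarrow> real \<Rightarrow> real \<Rightarrow> real \<Rightarrow> 'y \<Rightarrow> real" where
  "spread P \<Theta> L \<theta>s V2 D2 \<delta> \<rho> r y =
    diamond_upper P \<Theta> L \<theta>s V2 \<rho> r y + diamond_lower P \<Theta> L \<theta>s V2 \<rho> r y
    + ((norm (score \<Theta> L \<theta>s (D2_eps D2 V2 \<delta> \<rho>) y))\<^sup>2
       - (norm (score \<Theta> L \<theta>s (D2_eps D2 V2 (- \<delta>) (- \<rho>)) y))\<^sup>2) / 2"

text \<open>The event $C_\epsilon(r)$; \<open>\<theta>t\<close> is the estimator.\<close>

definition conc_event ::
  "'y measure \<Rightarrow> (real ^ 'p) set \<Rightarrow> ('y \<Rightarrow> real ^ 'p \<Rightarrow> real) \<Rightarrow> real ^ 'p \<Rightarrow> ('y \<Rightarrow> real ^ 'p)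
    \<Rightarrow> real ^ 'p ^ 'p \<Rightarrow> real ^ 'p ^ 'p \<Rightarrow> real \<Rightarrow> real \<Rightarrow> real \<Rightarrow> 'y set" where
  "conc_event P \<Theta> L \<theta>s \<theta>t V2 D2 \<delta> \<rho> r =
    {y \<in> space P. \<theta>t y \<in> local_set V2 \<theta>s r \<and>
      norm (mat_root V2 *v
        (matrix_inv (mat_root (D2_eps D2 V2 (- \<delta>) (- \<rho>)))
          *v score \<Theta> L \<theta>s (D2_eps D2 V2 (- \<delta>) (- \<rho>)) y)) \<le> r}"

section \<open>Local conditions\<close>

text \<open>Exponential moment condition on the gradient of the stochastic component. The exponential
  moment and the supremum may be infinite a priori. For \<open>\<omega> = 0\<close> the quotient is read as requiring
  that the gradient does not depend on the local parameter.\<close>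

definition grad_moment_cond ::
  "'y measure \<Rightarrow> (real ^ 'p) set \<Rightarrow> ('y \<Rightarrow> real ^ 'p \<Rightarrow> real) \<Rightarrow> real ^ 'p \<Rightarrow> real ^ 'p ^ 'p
    \<Rightarrow> real \<Rightarrow> real \<Rightarrow> real \<Rightarrow> real \<Rightarrow> bool" where
  "grad_moment_cond P \<Theta> L \<theta>s V2 g \<nu> \<omega> r \<longleftrightarrow>
    (\<forall>\<theta>\<in>local_set V2 \<theta>s r.
      if \<omega> = 0 then
        (AE y in P. grad_within \<Theta> (stoch P L y) \<theta> = grad_within \<Theta> (stoch P L y) \<theta>s)
      else
        (\<forall>t::real. \<bar>t\<bar> \<le> g \<longrightarrow>
          (SUP \<gamma>\<in>UNIV - {0}.
            ext_ln (\<integral>\<^sup>+ y. ennreal (exp (t *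
              ((\<gamma> \<bullet> (grad_within \<Theta> (stoch P L y) \<theta> - grad_within \<Theta> (stoch P L y) \<theta>s))
                / (\<omega> * norm (mat_root V2 *v \<gamma>))))) \<partial>P))
          \<le> ereal (\<nu>\<^sup>2 * t\<^sup>2 / 2)))"

definition quad_approx_cond ::
  "'y measure \<Rightarrow> ('y \<Rightarrow> real ^ 'p \<Rightarrow> real) \<Rightarrow> real ^ 'p \<Rightarrow> real ^ 'p ^ 'p \<Rightarrow> real ^ 'p ^ 'p
    \<Rightarrow> real \<Rightarrow> real \<Rightarrow> bool" where
  "quad_approx_cond P L \<theta>s V2 D2 d r \<longleftrightarrow>
    (\<forall>\<theta>\<in>local_set V2 \<theta>s r. \<theta> \<noteq> \<theta>s \<longrightarrow>
      \<bar>- 2 * (\<integral>y. (L y \<theta> - L y \<theta>s) \<partial>P) / (norm (mat_root D2 *v (\<theta> - \<theta>s)))\<^sup>2 - 1\<bar> \<le> d)"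

end

theory Submission
  imports Defs
begin

text \<open>
  Both inequalities hold pointwise in the data \<open>y\<close>, so they follow by monotonicity of the
  integral. Write $h = \theta - \theta^*$ and let $g = \nabla\zeta(\theta^*) = \nabla L(\theta^*)$;
  the two gradients agree because the mean of \<open>L\<close> has vanishing gradient at the target. On the
  local ellipsoid the quadratic approximation of the mean, together with the definition of
  $\Diamond_\epsilon$ and $\Diamond_{\underline\epsilon}$ as suprema of the remainder of $\zeta$,
  brackets the likelihood between two quadratic functions of \<open>h\<close>:
  \[
    h^\top g - \|D_{\underline\epsilon} h\|^2/2 - \Diamond_{\underline\epsilon}
    \le L(\theta, \theta^*) \le
    h^\top g - \|D_\epsilon h\|^2/2 + \Diamond_\epsilon .
  \]
  Completing the square, the right-hand side equals
  $\|\xi_\epsilon\|^2/2 - \|D_\epsilon h - \xi_\epsilon\|^2/2 + \Diamond_\epsilon$, and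
  dropping the negative square gives the first claim. For the second one, evaluate the lower
  bound at the maximizer $h = D_{\underline\epsilon}^{-1}\xi_{\underline\epsilon}$ of its
  quadratic part, which on the event $C_\epsilon$ is a point of the ellipsoid. The estimator has at
  least the likelihood of this point, hence
  $\|\xi_{\underline\epsilon}\|^2/2 - \Diamond_{\underline\epsilon} \le
  \|\xi_\epsilon\|^2/2 - \|D_\epsilon h - \xi_\epsilon\|^2/2 + \Diamond_\epsilon$ at
  $h = \tilde\theta - \theta^*$. This says that the distance from $D_\epsilon h$ to $\xi_\epsilon$
  is at most $\sqrt{2\Delta_\epsilon}$, and the triangle inequality finishes the proof.

  The suprema are finite since $\zeta$ is continuous on the compact ellipsoid. The remaining
  ingredient is that symmetric positive-definite matrices have a unique symmetric
  positive-definite root; it comes from an orthonormal basis of eigenvectors.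
\<close>

section \<open>Eigenbases of self-adjoint maps\<close>

text \<open>A maximizer of the quadratic form \<open>x \<bullet> f x\<close> on the unit sphere of an invariant subspace is
  an eigenvector: if \<open>c\<close> is the maximum, then \<open>c * (x \<bullet> x) - x \<bullet> f x\<close> is a nonnegative
  quadratic form vanishing at the maximizer, so its polar form vanishes there too.\<close>

lemma self_adjoint_eigenvector:
  fixes f :: "'a::euclidean_space \<Rightarrow> 'a"
  assumes lin: "linear f" and sa: "\<And>x y. f x \<bullet> y = x \<bullet> f y"
    and S: "subspace S" "f ` S \<subseteq> S" "S \<noteq> {0}"
  obtains v c where "v \<in> S" "norm v = 1" "f v = c *\<^sub>R v"
proof -
  let ?K = "sphere 0 1 \<inter> S"
  have "0 \<in> S" using S(1) by (rule subspace_0)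
  then obtain x where x: "x \<in> S" "x \<noteq> 0" using S(3) by blast
  then have "x /\<^sub>R norm x \<in> ?K" using S(1) by (simp add: subspace_scale)
  then have ne: "?K \<noteq> {}" by blast
  have comp: "compact ?K" using S(1) by (simp add: closed_subspace compact_Int_closed)
  have cont: "continuous_on ?K (\<lambda>x. x \<bullet> f x)"
    using lin by (intro continuous_intros linear_continuous_on) (simp add: linear_conv_bounded_linear)
  obtain v where v: "v \<in> ?K" and max: "\<And>x. x \<in> ?K \<Longrightarrow> x \<bullet> f x \<le> v \<bullet> f v"
    using continuous_attains_sup[OF comp ne cont] by blast
  define c where "c = v \<bullet> f v"
  have vS: "v \<in> S" and nv: "norm v = 1" using v by auto
  have vv: "v \<bullet> v = 1" using nv by (simp add: dot_square_norm)
  have form: "x \<bullet> f x \<le> c * (x \<bullet> x)" if xS: "x \<in> S" for x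
  proof (cases "x = 0")
    case True
    then show ?thesis using lin by (simp add: linear_0)
  next
    case False
    then have "x /\<^sub>R norm x \<in> ?K" using xS S(1) by (simp add: subspace_scale)
    from max[OF this] have "(x \<bullet> f x) / (norm x)\<^sup>2 \<le> c"
      using lin by (simp add: linear_scale c_def power2_eq_square divide_inverse mult_ac)
    then show ?thesis using False by (simp add: divide_le_eq dot_square_norm)
  qed
  define w where "w = c *\<^sub>R v - f v"
  have wS: "w \<in> S" unfolding w_def using vS S by (auto intro!: subspace_diff subspace_scale)
  define q where "q = c * (w \<bullet> w) - w \<bullet> f w"
  have "0 \<le> q" using form[OF wS] by (simp add: q_def)
  have expand: "0 \<le> t\<^sup>2 * q + 2 * t * (w \<bullet> w)" for t
  proof -
    have "v + t *\<^sub>R w \<in> S" using vS wS S(1) by (simp add: subspace_add subspace_scale)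
    from form[OF this]
    have "0 \<le> c * ((v + t *\<^sub>R w) \<bullet> (v + t *\<^sub>R w)) - (v + t *\<^sub>R w) \<bullet> (f v + t *\<^sub>R f w)"
      using lin by (simp add: linear_add linear_scale)
    also have "\<dots> = t\<^sup>2 * q + 2 * t * (w \<bullet> (c *\<^sub>R v - f v))"
      using sa[of v w] vv
      by (simp add: inner_simps c_def[symmetric] q_def power2_eq_square algebra_simps inner_commute)
    finally show ?thesis by (simp add: w_def)
  qed
  have "w \<bullet> w = 0"
  proof (rule ccontr)
    assume "w \<bullet> w \<noteq> 0"
    then have pos: "w \<bullet> w > 0" by simp
    \<comment> \<open>A small negative \<open>t\<close> makes the linear term dominate.\<close>
    define s where "s = (w \<bullet> w) / (q + 1)"
    have s: "0 < s" "s * (q + 1) = w \<bullet> w" using pos \<open>0 \<le> q\<close> by (simp_all add: s_def)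
    have "0 \<le> s * (s * q - 2 * (w \<bullet> w))"
      using expand[of "- s"] by (simp add: power2_eq_square algebra_simps)
    then have "2 * (w \<bullet> w) \<le> s * q" using s(1) by (simp add: zero_le_mult_iff)
    then show False using s pos by (simp add: algebra_simps)
  qed
  then have "f v = c *\<^sub>R v" by (simp add: w_def)
  then show thesis using that vS nv by blast
qed

text \<open>Split off one eigenvector: the orthogonal complement is again invariant, and of smaller
  dimension.\<close>

lemma self_adjoint_eigenbasis:
  fixes f :: "'a::euclidean_space \<Rightarrow> 'a"
  assumes lin: "linear f" and sa: "\<And>x y. f x \<bullet> y = x \<bullet> f y"
    and S: "subspace S" "f ` S \<subseteq> S"
  shows "\<exists>B. finite B \<and> pairwise orthogonal B \<and> span B = S
    \<and> (\<forall>b\<in>B. norm b = 1 \<and> (\<exists>c. f b = c *\<^sub>R b))"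
  using S
proof (induction "dim S" arbitrary: S rule: less_induct)
  case less
  show ?case
  proof (cases "S = {0}")
    case True
    then show ?thesis by (intro exI[of _ "{}"]) auto
  next
    case False
    then obtain v c where v: "v \<in> S" "norm v = 1" "f v = c *\<^sub>R v"
      using self_adjoint_eigenvector[OF lin sa] less.prems by metis
    have vv: "v \<bullet> v = 1" using v(2) by (simp add: dot_square_norm)
    define T where "T = S \<inter> {x. v \<bullet> x = 0}"
    have T: "subspace T" unfolding T_def
      using less.prems(1) by (intro subspace_inter subspace_hyperplane)
    have "v \<notin> T" using vv by (simp add: T_def)
    then have "T \<subset> S" using v(1) unfolding T_def by blast
    then have "dim T < dim S"
      using T less.prems(1) by (intro dim_psubset) (simp add: span_eq_iff[THEN iffD2])
    moreover have "f ` T \<subseteq> T"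
      using less.prems(2) sa[of v, symmetric] v(3) by (auto simp: T_def)
    ultimately obtain B where B: "finite B" "pairwise orthogonal B" "span B = T"
      "\<forall>b\<in>B. norm b = 1 \<and> (\<exists>c. f b = c *\<^sub>R b)"
      using less.hyps T by blast
    have "B \<subseteq> T" using B(3) span_superset by blast
    then have orth: "pairwise orthogonal (insert v B)"
      using B(2) by (auto simp: pairwise_insert orthogonal_def T_def inner_commute)
    have "span (insert v B) = S"
    proof
      show "span (insert v B) \<subseteq> S"
        using v(1) \<open>B \<subseteq> T\<close> less.prems(1) by (intro span_minimal) (auto simp: T_def)
      show "S \<subseteq> span (insert v B)"
      proof
        fix x assume "x \<in> S"
        then have "x - (v \<bullet> x) *\<^sub>R v \<in> T"
          using v(1) vv less.prems(1)
          by (auto simp: T_def inner_diff_right intro!: subspace_diff subspace_scale)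
        then show "x \<in> span (insert v B)" using B(3) span_breakdown_eq by blast
      qed
    qed
    then show ?thesis using B v orth by (intro exI[of _ "insert v B"]) auto
  qed
qed

section \<open>The root of a positive-definite matrix\<close>

lemma sym_inner:
  fixes A :: "real ^ 'n ^ 'n"
  assumes "transpose A = A"
  shows "(A *v x) \<bullet> y = x \<bullet> (A *v y)"
  by (metis assms dot_lmul_matrix vector_transpose_matrix)

lemma sym_posdef_inner_pos: "sym_posdef A \<Longrightarrow> x \<noteq> 0 \<Longrightarrow> 0 < x \<bullet> (A *v x)"
  by (simp add: sym_posdef_def)

lemma sym_posdef_sym_inner: "sym_posdef A \<Longrightarrow> (A *v x) \<bullet> y = x \<bullet> (A *v y)"
  by (simp add: sym_posdef_def sym_inner)

lemma sym_posdef_eigenbasis: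
  fixes A :: "real ^ 'n ^ 'n"
  assumes "sym_posdef A"
  obtains B c where "finite B" "pairwise orthogonal B" "span B = UNIV"
    "\<And>b. b \<in> B \<Longrightarrow> norm b = 1" "\<And>b. b \<in> B \<Longrightarrow> A *v b = c b *\<^sub>R b" "\<And>b. b \<in> B \<Longrightarrow> 0 < c b"
proof -
  obtain B where B: "finite B" "pairwise orthogonal B" "span B = UNIV"
    "\<forall>b\<in>B. norm b = 1 \<and> (\<exists>c. A *v b = c *\<^sub>R b)"
    using self_adjoint_eigenbasis[of "(*v) A" UNIV] sym_posdef_sym_inner[OF assms] by auto
  then obtain c where c: "\<And>b. b \<in> B \<Longrightarrow> A *v b = c b *\<^sub>R b" by metis
  have "0 < c b" if "b \<in> B" for b
  proof -
    have "norm b = 1" using B(4) that by blast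
    then have "b \<noteq> 0" "b \<bullet> b = 1" by (auto simp: dot_square_norm)
    then show ?thesis using sym_posdef_inner_pos[OF assms, of b] c[OF that] by simp
  qed
  then show thesis using that B c by blast
qed

lemma matrix_eq_on_spanning_set:
  fixes A C :: "real ^ 'n ^ 'n"
  assumes "span B = UNIV" "\<And>b. b \<in> B \<Longrightarrow> A *v b = C *v b"
  shows "A = C"
proof -
  have "A *v x = C *v x" for x
    using linear_eq_on_span[of "(*v) A" "(*v) C" B x] assms by simp
  then show ?thesis by (simp add: matrix_eq)
qed

lemma sym_posdef_root_exists:
  fixes A :: "real ^ 'n ^ 'n"
  assumes "sym_posdef A"
  shows "\<exists>R. sym_posdef R \<and> R ** R = A"
proof -
  obtain B c where fin: "finite B" and orth: "pairwise orthogonal B" and sp: "span B = UNIV"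
    and norm1: "\<And>b. b \<in> B \<Longrightarrow> norm b = 1" and eig: "\<And>b. b \<in> B \<Longrightarrow> A *v b = c b *\<^sub>R b"
    and cpos: "\<And>b. b \<in> B \<Longrightarrow> 0 < c b"
    using sym_posdef_eigenbasis[OF assms] by metis
  define f where "f x = (\<Sum>b\<in>B. (sqrt (c b) * (b \<bullet> x)) *\<^sub>R b)" for x :: "real ^ 'n"
  have lin: "linear f"
    by (rule linearI)
      (simp_all add: f_def inner_add_right algebra_simps sum.distrib scaleR_sum_right)
  define R where "R = matrix f"
  have R: "R *v x = f x" for x using lin by (simp add: R_def matrix_works)
  have Rb: "R *v b = sqrt (c b) *\<^sub>R b" if b: "b \<in> B" for b
  proof -
    have "(sqrt (c b') * (b' \<bullet> b)) *\<^sub>R b' = (if b' = b then sqrt (c b) *\<^sub>R b else 0)" if "b' \<in> B" for b'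
      using orth that b norm1[OF b]
      by (auto simp: pairwise_def orthogonal_def dot_square_norm)
    then have "f b = (\<Sum>b'\<in>B. if b' = b then sqrt (c b) *\<^sub>R b else 0)"
      unfolding f_def by (rule sum.cong[OF refl])
    then show ?thesis using fin b R by simp
  qed
  have sa: "(R *v x) \<bullet> y = x \<bullet> (R *v y)" for x y
    unfolding R f_def by (simp add: inner_sum_left inner_sum_right inner_commute mult_ac)
  have "transpose R *v x = R *v x" for x
    by (metis dot_lmul_matrix sa transpose_matrix_vector vector_eq_rdot)
  then have "transpose R = R" by (simp add: matrix_eq)
  moreover have "0 < x \<bullet> (R *v x)" if "x \<noteq> 0" for x
  proof -
    have eq: "x \<bullet> (R *v x) = (\<Sum>b\<in>B. sqrt (c b) * (b \<bullet> x)\<^sup>2)"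
      unfolding R f_def by (simp add: inner_sum_right inner_commute power2_eq_square mult_ac)
    obtain b where b: "b \<in> B" "b \<bullet> x \<noteq> 0"
    proof (rule ccontr)
      assume "\<not> thesis"
      then have "\<And>b. b \<in> B \<Longrightarrow> orthogonal x b"
        using that by (auto simp: orthogonal_def inner_commute)
      then have "orthogonal x x" using sp orthogonal_to_span[of x B x] by auto
      then show False using \<open>x \<noteq> 0\<close> by (simp add: orthogonal_def)
    qed
    have "0 < (\<Sum>b\<in>B. sqrt (c b) * (b \<bullet> x)\<^sup>2)"
      using b cpos[OF b(1)] by (intro sum_pos2[OF fin b(1)]) (auto simp: less_imp_le[OF cpos])
    then show ?thesis using eq by simp
  qed
  ultimately have "sym_posdef R" by (simp add: sym_posdef_def)
  moreover have "R ** R = A"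
  proof (rule matrix_eq_on_spanning_set[OF sp])
    fix b assume b: "b \<in> B"
    then show "(R ** R) *v b = A *v b"
      using Rb cpos[OF b] eig
      by (simp add: matrix_vector_mul_assoc[symmetric] matrix_vector_mult_scaleR)
  qed
  ultimately show ?thesis by blast
qed

text \<open>On an eigenvector \<open>b\<close> of \<open>R\<close> with eigenvalue \<open>c\<close>, any other root \<open>Q\<close> satisfies
  \<open>(Q + c) (Q - c) b = Q\<^sup>2 b - R\<^sup>2 b = 0\<close>, and \<open>Q + c\<close> is positive definite; so \<open>Q b = c b\<close>.\<close>

lemma sym_posdef_root_unique:
  fixes R Q :: "real ^ 'n ^ 'n"
  assumes R: "sym_posdef R" and Q: "sym_posdef Q" and eq: "R ** R = Q ** Q"
  shows "R = Q"
proof -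
  obtain B c where sp: "span B = UNIV" and eig: "\<And>b. b \<in> B \<Longrightarrow> R *v b = c b *\<^sub>R b"
    and cpos: "\<And>b. b \<in> B \<Longrightarrow> 0 < c b"
    using sym_posdef_eigenbasis[OF R] by metis
  show ?thesis
  proof (rule matrix_eq_on_spanning_set[OF sp])
    fix b assume b: "b \<in> B"
    define w where "w = Q *v b - c b *\<^sub>R b"
    have "Q *v (Q *v b) = R *v (R *v b)" by (simp add: matrix_vector_mul_assoc eq)
    then have "Q *v (Q *v b) = (c b * c b) *\<^sub>R b"
      using eig[OF b] by (simp add: matrix_vector_mult_scaleR)
    then have "Q *v w = - (c b *\<^sub>R w)"
      by (simp add: w_def matrix_vector_mult_diff_distrib matrix_vector_mult_scaleR algebra_simps)
    then have "w \<bullet> (Q *v w) = - (c b * (w \<bullet> w))" by simp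
    then have "w \<bullet> (Q *v w) \<le> 0" using cpos[OF b] by simp
    then have "w = 0" using sym_posdef_inner_pos[OF Q, of w] by force
    then show "R *v b = Q *v b" using eig[OF b] by (simp add: w_def)
  qed
qed

lemma mat_root:
  fixes A :: "real ^ 'n ^ 'n"
  assumes "sym_posdef A"
  shows sym_posdef_mat_root: "sym_posdef (mat_root A)"
    and mat_root_square: "mat_root A ** mat_root A = A"
proof -
  have "\<exists>!R. sym_posdef R \<and> R ** R = A"
    using sym_posdef_root_exists[OF assms] sym_posdef_root_unique by metis
  from theI'[OF this] show "sym_posdef (mat_root A)" "mat_root A ** mat_root A = A"
    by (simp_all add: mat_root_def)
qed

lemma norm_mat_root_square:
  fixes A :: "real ^ 'n ^ 'n"
  assumes "sym_posdef A"
  shows "(norm (mat_root A *v x))\<^sup>2 = x \<bullet> (A *v x)"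
  using sym_posdef_sym_inner[OF sym_posdef_mat_root[OF assms], of x "mat_root A *v x"]
    mat_root_square[OF assms]
  by (simp add: dot_square_norm[symmetric] matrix_vector_mul_assoc)

lemma sym_posdef_matrix_inv_right:
  fixes A :: "real ^ 'n ^ 'n"
  assumes "sym_posdef A"
  shows "A *v (matrix_inv A *v x) = x"
proof -
  have "x = 0" if "A *v x = 0" for x
    using sym_posdef_inner_pos[OF assms, of x] that by force
  then have "invertible A"
    by (simp add: invertible_left_inverse matrix_left_invertible_ker)
  then have "A ** matrix_inv A = mat 1"
    unfolding invertible_def matrix_inv_def by (rule someI2_ex) simp
  then show ?thesis by (simp add: matrix_vector_mul_assoc)
qed

text \<open>The linear term \<open>h \<bullet> g\<close> of a quadratic expansion, in the coordinates in which the
  quadratic form \<open>A\<close> becomes the squared norm.\<close>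

lemma inner_mat_root_standardized:
  fixes A :: "real ^ 'n ^ 'n"
  assumes "sym_posdef A"
  shows "(mat_root A *v h) \<bullet> (matrix_inv (mat_root A) *v g) = h \<bullet> g"
  using sym_posdef_mat_root[OF assms]
  by (simp add: sym_posdef_sym_inner sym_posdef_matrix_inv_right)

lemma D2_eps_quadratic:
  "x \<bullet> (D2_eps D2 V2 \<delta> \<rho> *v x) = (1 - \<delta>) * (x \<bullet> (D2 *v x)) - \<rho> * (x \<bullet> (V2 *v x))"
  by (simp add: D2_eps_def matrix_vector_mult_diff_rdistrib scaleR_matrix_vector_assoc[symmetric]
      inner_diff_right)

lemma sym_posdef_D2_eps_lower:
  assumes "sym_posdef D2" "sym_posdef V2" "0 \<le> \<delta>" "0 \<le> \<rho>"
  shows "sym_posdef (D2_eps D2 V2 (- \<delta>) (- \<rho>))"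
proof -
  have "transpose (D2_eps D2 V2 (- \<delta>) (- \<rho>)) = D2_eps D2 V2 (- \<delta>) (- \<rho>)"
    using assms(1,2) by (simp add: sym_posdef_def D2_eps_def transpose_def vec_eq_iff)
  moreover have "0 < x \<bullet> (D2_eps D2 V2 (- \<delta>) (- \<rho>) *v x)" if "x \<noteq> 0" for x
    using sym_posdef_inner_pos[OF assms(1) that] sym_posdef_inner_pos[OF assms(2) that] assms(3,4)
    by (simp add: D2_eps_quadratic add_pos_nonneg)
  ultimately show ?thesis by (simp add: sym_posdef_def)
qed

section \<open>The local bracketing\<close>

lemma compact_local_set:
  assumes "sym_posdef V2"
  shows "compact (local_set V2 \<theta>s r)"
proof -
  let ?R = "mat_root V2"
  have R: "sym_posdef ?R" using assms by (rule sym_posdef_mat_root)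
  have inj: "x = y" if "?R *v x = ?R *v y" for x y
    using sym_posdef_inner_pos[OF R, of "x - y"] that
    by (force simp: matrix_vector_mult_diff_distrib)
  have "local_set V2 \<theta>s r = (\<lambda>z. \<theta>s + matrix_inv ?R *v z) ` cball 0 r"
  proof (intro set_eqI iffI)
    fix \<theta> assume "\<theta> \<in> local_set V2 \<theta>s r"
    moreover have "\<theta> - \<theta>s = matrix_inv ?R *v (?R *v (\<theta> - \<theta>s))"
      by (rule inj) (simp add: sym_posdef_matrix_inv_right[OF R])
    ultimately show "\<theta> \<in> (\<lambda>z. \<theta>s + matrix_inv ?R *v z) ` cball 0 r"
      by (intro image_eqI[of _ _ "?R *v (\<theta> - \<theta>s)"]) (auto simp: local_set_def algebra_simps)
  qed (auto simp: local_set_def sym_posdef_matrix_inv_right[OF R])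
  moreover have "continuous_on (cball 0 r) (\<lambda>z. \<theta>s + matrix_inv ?R *v z)"
    by (intro continuous_intros matrix_vector_mult_linear_continuous_on)
  ultimately show ?thesis by (simp add: compact_continuous_image)
qed

text \<open>A real supremum bounds its members only when the set is bounded above; here that holds
  because a continuous function is bounded on the compact ellipsoid.\<close>

lemma diamond_bounds:
  assumes V2: "sym_posdef V2" and cont: "continuous_on (local_set V2 \<theta>s r) (stoch P L y)"
    and \<theta>: "\<theta> \<in> local_set V2 \<theta>s r"
  shows "stoch P L y \<theta> - stoch P L y \<theta>s - (\<theta> - \<theta>s) \<bullet> grad_within \<Theta> (stoch P L y) \<theta>s
      - \<rho> / 2 * (norm (mat_root V2 *v (\<theta> - \<theta>s)))\<^sup>2 \<le> diamond_upper P \<Theta> L \<theta>s V2 \<rho> r y"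
    and "- (stoch P L y \<theta> - stoch P L y \<theta>s) + (\<theta> - \<theta>s) \<bullet> grad_within \<Theta> (stoch P L y) \<theta>s
      - \<rho> / 2 * (norm (mat_root V2 *v (\<theta> - \<theta>s)))\<^sup>2 \<le> diamond_lower P \<Theta> L \<theta>s V2 \<rho> r y"
proof -
  have bdd: "bdd_above (F ` local_set V2 \<theta>s r)" if "continuous_on (local_set V2 \<theta>s r) F"
    for F :: "real ^ 'a \<Rightarrow> real"
    using compact_continuous_image[OF that compact_local_set[OF V2]]
    by (intro bounded_imp_bdd_above compact_imp_bounded)
  have lin: "continuous_on (local_set V2 \<theta>s r) (\<lambda>\<theta>. mat_root V2 *v (\<theta> - \<theta>s))"
    by (rule continuous_on_compose2[OF matrix_vector_mult_linear_continuous_on])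
      (auto intro!: continuous_intros)
  show "stoch P L y \<theta> - stoch P L y \<theta>s - (\<theta> - \<theta>s) \<bullet> grad_within \<Theta> (stoch P L y) \<theta>s
      - \<rho> / 2 * (norm (mat_root V2 *v (\<theta> - \<theta>s)))\<^sup>2 \<le> diamond_upper P \<Theta> L \<theta>s V2 \<rho> r y"
    unfolding diamond_upper_def
    by (rule cSUP_upper[OF \<theta>], rule bdd) (intro continuous_intros cont lin)
  show "- (stoch P L y \<theta> - stoch P L y \<theta>s) + (\<theta> - \<theta>s) \<bullet> grad_within \<Theta> (stoch P L y) \<theta>s
      - \<rho> / 2 * (norm (mat_root V2 *v (\<theta> - \<theta>s)))\<^sup>2 \<le> diamond_lower P \<Theta> L \<theta>s V2 \<rho> r y"
    unfolding diamond_lower_def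
    by (rule cSUP_upper[OF \<theta>], rule bdd) (intro continuous_intros cont lin)
qed

text \<open>Adding a function with vanishing gradient at \<open>\<theta>s\<close> leaves the set of candidate gradients
  unchanged, so the two definite descriptions coincide whether or not they denote.\<close>

lemma grad_within_stoch_eq:
  assumes "GDERIV (mean_lik P L) \<theta>s :> 0"
  shows "grad_within \<Theta> (stoch P L y) \<theta>s = grad_within \<Theta> (L y) \<theta>s"
proof -
  have mean: "(mean_lik P L has_derivative (\<lambda>h. 0)) (at \<theta>s within \<Theta>)"
    using assms by (auto simp: gderiv_def intro: has_derivative_at_withinI)
  have "(stoch P L y has_derivative (\<lambda>h. h \<bullet> g)) (at \<theta>s within \<Theta>)
      \<longleftrightarrow> (L y has_derivative (\<lambda>h. h \<bullet> g)) (at \<theta>s within \<Theta>)" for g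
  proof
    assume "(stoch P L y has_derivative (\<lambda>h. h \<bullet> g)) (at \<theta>s within \<Theta>)"
    from has_derivative_add[OF this mean]
    show "(L y has_derivative (\<lambda>h. h \<bullet> g)) (at \<theta>s within \<Theta>)" by (simp add: stoch_def)
  next
    assume "(L y has_derivative (\<lambda>h. h \<bullet> g)) (at \<theta>s within \<Theta>)"
    from has_derivative_diff[OF this mean]
    show "(stoch P L y has_derivative (\<lambda>h. h \<bullet> g)) (at \<theta>s within \<Theta>)"
      by (simp add: stoch_def[abs_def])
  qed
  then show ?thesis by (simp add: grad_within_def)
qed

lemma mean_lik_quadratic_bounds:
  assumes int: "integrable P (\<lambda>y. L y \<theta>)" "integrable P (\<lambda>y. L y \<theta>s)"
    and cond: "quad_approx_cond P L \<theta>s V2 D2 d r" and D2: "sym_posdef D2"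
    and \<theta>: "\<theta> \<in> local_set V2 \<theta>s r" and \<delta>: "d \<le> \<delta>"
  shows "mean_lik P L \<theta> - mean_lik P L \<theta>s \<le> - (1 - \<delta>) / 2 * ((\<theta> - \<theta>s) \<bullet> (D2 *v (\<theta> - \<theta>s)))"
    and "- (1 + \<delta>) / 2 * ((\<theta> - \<theta>s) \<bullet> (D2 *v (\<theta> - \<theta>s))) \<le> mean_lik P L \<theta> - mean_lik P L \<theta>s"
proof -
  define N where "N = (\<theta> - \<theta>s) \<bullet> (D2 *v (\<theta> - \<theta>s))"
  define m where "m = mean_lik P L \<theta> - mean_lik P L \<theta>s"
  have "m \<le> - (1 - \<delta>) / 2 * N \<and> - (1 + \<delta>) / 2 * N \<le> m"
  proof (cases "\<theta> = \<theta>s")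
    case True
    then show ?thesis by (simp add: m_def N_def)
  next
    case False
    then have N: "N > 0" using sym_posdef_inner_pos[OF D2, of "\<theta> - \<theta>s"] by (simp add: N_def)
    have m: "(\<integral>y. (L y \<theta> - L y \<theta>s) \<partial>P) = m" using int by (simp add: m_def mean_lik_def)
    have "\<bar>- 2 * m / N - 1\<bar> \<le> d"
      using cond \<theta> False
      unfolding quad_approx_cond_def norm_mat_root_square[OF D2] m[symmetric] N_def by blast
    then have "1 - \<delta> \<le> - 2 * m / N" "- 2 * m / N \<le> 1 + \<delta>" using \<delta> by linarith+
    then have "(1 - \<delta>) * N \<le> - 2 * m" "- 2 * m \<le> (1 + \<delta>) * N"
      using N by (simp_all only: pos_le_divide_eq pos_divide_le_eq)
    then show ?thesis by (simp add: field_simps)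
  qed
  then show "mean_lik P L \<theta> - mean_lik P L \<theta>s \<le> - (1 - \<delta>) / 2 * ((\<theta> - \<theta>s) \<bullet> (D2 *v (\<theta> - \<theta>s)))"
    "- (1 + \<delta>) / 2 * ((\<theta> - \<theta>s) \<bullet> (D2 *v (\<theta> - \<theta>s))) \<le> mean_lik P L \<theta> - mean_lik P L \<theta>s"
    by (simp_all add: m_def N_def)
qed

text \<open>The quadratic expansion around \<open>\<theta>s\<close> with matrix \<open>A\<close>, completed to a square.\<close>

lemma score_complete_square:
  fixes A :: "real ^ 'p ^ 'p"
  assumes "sym_posdef A"
  shows "h \<bullet> grad_within \<Theta> (L y) \<theta>s - h \<bullet> (A *v h) / 2
    = (norm (score \<Theta> L \<theta>s A y))\<^sup>2 / 2 - (norm (mat_root A *v h - score \<Theta> L \<theta>s A y))\<^sup>2 / 2"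
  using inner_mat_root_standardized[OF assms, of h "grad_within \<Theta> (L y) \<theta>s"]
    norm_mat_root_square[OF assms, of h]
  by (simp add: score_def dot_square_norm[symmetric] inner_diff_left inner_diff_right inner_commute
      field_simps)

text \<open>The upper bound combines the mean bound and the supremum \<open>diamond_upper\<close>; the penalty
  \<open>\<rho> / 2 * \<parallel>V\<^sub>0 h\<parallel>\<^sup>2\<close> cancels against the \<open>\<rho>\<close> part of \<open>D2_eps\<close>. The lower bound is the mirror
  image.\<close>

lemma likelihood_bracket:
  fixes \<theta> \<theta>s :: "real ^ 'p" and L :: "'y \<Rightarrow> real ^ 'p \<Rightarrow> real"
  assumes V2: "sym_posdef V2" and D2: "sym_posdef D2"
    and cont: "continuous_on (local_set V2 \<theta>s r) (stoch P L y)"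
    and grad: "GDERIV (mean_lik P L) \<theta>s :> 0"
    and int: "integrable P (\<lambda>y. L y \<theta>)" "integrable P (\<lambda>y. L y \<theta>s)"
    and cond: "quad_approx_cond P L \<theta>s V2 D2 d r" and \<delta>: "d \<le> \<delta>"
    and \<theta>: "\<theta> \<in> local_set V2 \<theta>s r"
  shows likelihood_upper: "sym_posdef (D2_eps D2 V2 \<delta> \<rho>) \<Longrightarrow>
      L y \<theta> - L y \<theta>s \<le> (norm (score \<Theta> L \<theta>s (D2_eps D2 V2 \<delta> \<rho>) y))\<^sup>2 / 2
        - (norm (mat_root (D2_eps D2 V2 \<delta> \<rho>) *v (\<theta> - \<theta>s) - score \<Theta> L \<theta>s (D2_eps D2 V2 \<delta> \<rho>) y))\<^sup>2 / 2
        + diamond_upper P \<Theta> L \<theta>s V2 \<rho> r y" (is "_ \<Longrightarrow> ?U")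
    and likelihood_lower: "sym_posdef (D2_eps D2 V2 (- \<delta>) (- \<rho>)) \<Longrightarrow>
      (norm (score \<Theta> L \<theta>s (D2_eps D2 V2 (- \<delta>) (- \<rho>)) y))\<^sup>2 / 2
        - (norm (mat_root (D2_eps D2 V2 (- \<delta>) (- \<rho>)) *v (\<theta> - \<theta>s)
            - score \<Theta> L \<theta>s (D2_eps D2 V2 (- \<delta>) (- \<rho>)) y))\<^sup>2 / 2
        - diamond_lower P \<Theta> L \<theta>s V2 \<rho> r y \<le> L y \<theta> - L y \<theta>s" (is "_ \<Longrightarrow> ?W")
proof -
  note sup = diamond_bounds[OF V2 cont \<theta>, of \<Theta> \<rho>,
      unfolded grad_within_stoch_eq[OF grad] norm_mat_root_square[OF V2]]
  note mean = mean_lik_quadratic_bounds[OF int cond D2 \<theta> \<delta>]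
  have split: "L y \<theta> - L y \<theta>s =
      (stoch P L y \<theta> - stoch P L y \<theta>s) + (mean_lik P L \<theta> - mean_lik P L \<theta>s)"
    by (simp add: stoch_def)
  show ?U if "sym_posdef (D2_eps D2 V2 \<delta> \<rho>)"
    unfolding score_complete_square[OF that, symmetric] D2_eps_quadratic split
    using sup(1) mean(1) by (simp add: field_simps)
  show ?W if "sym_posdef (D2_eps D2 V2 (- \<delta>) (- \<rho>))"
    unfolding score_complete_square[OF that, symmetric] D2_eps_quadratic split
    using sup(2) mean(2) by (simp add: field_simps)
qed

theorem corollary3p6:
  fixes P :: "'y measure"
    and \<Theta> :: "(real ^ 'p) set"
    and L :: "'y \<Rightarrow> real ^ 'p \<Rightarrow> real"
    and \<theta>s :: "real ^ 'p"
    and \<theta>t :: "'y \<Rightarrow> real ^ 'p"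
    and V2 D2 :: "real ^ 'p ^ 'p"
    and g \<nu> r0 r \<omega> d \<rho> \<delta> u :: real
  assumes P: "prob_space P"
    and L_int: "\<And>\<theta>. \<theta> \<in> \<Theta> \<Longrightarrow> integrable P (\<lambda>y. L y \<theta>)"
    and est_meas: "\<theta>t \<in> borel_measurable P"
    and est: "\<And>y. y \<in> space P \<Longrightarrow> is_arg_max (L y) (\<lambda>\<theta>. \<theta> \<in> \<Theta>) (\<theta>t y)"
    and target: "is_arg_max (mean_lik P L) (\<lambda>\<theta>. \<theta> \<in> \<Theta>) \<theta>s"
    and target_grad: "GDERIV (mean_lik P L) \<theta>s :> 0"
    and stoch_diff: "\<And>y. y \<in> space P \<Longrightarrow> stoch P L y differentiable_on \<Theta>"
    and V2: "sym_posdef V2"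
    and pos: "g > 0" "\<nu> \<ge> 1" "r0 > 0"
    and ellipsoid: "\<And>s. s \<le> r0 \<Longrightarrow> local_set V2 \<theta>s s \<subseteq> \<Theta>"
    and r: "r \<le> r0"
    and \<omega>: "\<omega> \<in> {0..1/2}"
    and cond_i: "grad_moment_cond P \<Theta> L \<theta>s V2 g \<nu> \<omega> r"
    and D2: "sym_posdef D2"
    and d: "d \<in> {0..1/2}"
    and cond_ii: "quad_approx_cond P L \<theta>s V2 D2 d r"
    and \<rho>: "\<rho> \<ge> 3 * \<nu> * \<omega>"
    and \<delta>: "\<delta> \<ge> d"
    and D_eps: "sym_posdef (D2_eps D2 V2 \<delta> \<rho>)"
    and u: "u > 0"
  shows "((\<integral>\<^sup>+ y. ennreal ((L y (\<theta>t y) - L y \<theta>s) powr u)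
            * indicator {y \<in> space P. \<theta>t y \<in> local_set V2 \<theta>s r} y \<partial>P)
         \<le> (\<integral>\<^sup>+ y. ennreal (((norm (score \<Theta> L \<theta>s (D2_eps D2 V2 \<delta> \<rho>) y))\<^sup>2 / 2
                + diamond_upper P \<Theta> L \<theta>s V2 \<rho> r y) powr u) \<partial>P))
    \<and> ((\<integral>\<^sup>+ y. ennreal ((norm (mat_root (D2_eps D2 V2 \<delta> \<rho>) *v (\<theta>t y - \<theta>s))) powr u)
            * indicator (conc_event P \<Theta> L \<theta>s \<theta>t V2 D2 \<delta> \<rho> r) y \<partial>P)
         \<le> (\<integral>\<^sup>+ y. ennreal ((norm (score \<Theta> L \<theta>s (D2_eps D2 V2 \<delta> \<rho>) y)
                + sqrt (2 * spread P \<Theta> L \<theta>s V2 D2 \<delta> \<rho> r y)) powr u) \<partial>P))"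
proof -
  have \<theta>s: "\<theta>s \<in> \<Theta>" using target by (simp add: is_arg_max_def)
  have sub: "local_set V2 \<theta>s r \<subseteq> \<Theta>" using ellipsoid r by blast
  have "0 \<le> 3 * \<nu> * \<omega>" using pos \<omega> by simp
  then have \<rho>0: "0 \<le> \<rho>" using \<rho> by linarith
  have \<delta>0: "0 \<le> \<delta>" using \<delta> d by simp
  let ?U = "D2_eps D2 V2 \<delta> \<rho>" and ?W = "D2_eps D2 V2 (- \<delta>) (- \<rho>)"
  let ?\<xi> = "score \<Theta> L \<theta>s ?U" and ?\<eta> = "score \<Theta> L \<theta>s ?W"
  let ?up = "diamond_upper P \<Theta> L \<theta>s V2 \<rho> r" and ?lo = "diamond_lower P \<Theta> L \<theta>s V2 \<rho> r"
  have W: "sym_posdef ?W" using sym_posdef_D2_eps_lower[OF D2 V2 \<delta>0 \<rho>0] .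
  have max: "L y \<theta> \<le> L y (\<theta>t y)" if "y \<in> space P" "\<theta> \<in> \<Theta>" for y \<theta>
    using est[OF that(1)] that(2) by (auto simp: is_arg_max_linorder)
  have cont: "continuous_on (local_set V2 \<theta>s r) (stoch P L y)" if "y \<in> space P" for y
    using differentiable_imp_continuous_on[OF stoch_diff[OF that]] sub
    by (rule continuous_on_subset)
  note bracket_args = V2 D2 cont target_grad L_int[OF subsetD[OF sub]] L_int[OF \<theta>s] cond_ii \<delta>
  have upper: "L y \<theta> - L y \<theta>s
      \<le> (norm (?\<xi> y))\<^sup>2 / 2 - (norm (mat_root ?U *v (\<theta> - \<theta>s) - ?\<xi> y))\<^sup>2 / 2 + ?up y"
    if "y \<in> space P" "\<theta> \<in> local_set V2 \<theta>s r" for y \<theta>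
    using likelihood_upper[OF bracket_args _ D_eps] that by blast
  have lower: "(norm (?\<eta> y))\<^sup>2 / 2 - (norm (mat_root ?W *v (\<theta> - \<theta>s) - ?\<eta> y))\<^sup>2 / 2 - ?lo y
      \<le> L y \<theta> - L y \<theta>s"
    if "y \<in> space P" "\<theta> \<in> local_set V2 \<theta>s r" for y \<theta>
    using likelihood_lower[OF bracket_args _ W] that by blast

  have excess: "(L y (\<theta>t y) - L y \<theta>s) powr u \<le> ((norm (?\<xi> y))\<^sup>2 / 2 + ?up y) powr u"
    if "y \<in> space P" "\<theta>t y \<in> local_set V2 \<theta>s r" for y
  proof (rule powr_mono2)
    show "0 \<le> u" using u by simp
    show "0 \<le> L y (\<theta>t y) - L y \<theta>s" using max[OF that(1) \<theta>s] by simp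
    have "0 \<le> (norm (mat_root ?U *v (\<theta>t y - \<theta>s) - ?\<xi> y))\<^sup>2" by simp
    then show "L y (\<theta>t y) - L y \<theta>s \<le> (norm (?\<xi> y))\<^sup>2 / 2 + ?up y"
      using upper[OF that] by linarith
  qed

  have distance: "norm (mat_root ?U *v (\<theta>t y - \<theta>s)) powr u
      \<le> (norm (?\<xi> y) + sqrt (2 * spread P \<Theta> L \<theta>s V2 D2 \<delta> \<rho> r y)) powr u"
    if C: "y \<in> conc_event P \<Theta> L \<theta>s \<theta>t V2 D2 \<delta> \<rho> r" for y
  proof (rule powr_mono2)
    have y: "y \<in> space P" and loc: "\<theta>t y \<in> local_set V2 \<theta>s r"
      using C by (simp_all add: conc_event_def)
    \<comment> \<open>The maximizer of the quadratic lower bound; its square term vanishes.\<close>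
    define \<theta>' where "\<theta>' = \<theta>s + matrix_inv (mat_root ?W) *v ?\<eta> y"
    have \<theta>': "\<theta>' \<in> local_set V2 \<theta>s r"
      using C by (simp add: conc_event_def local_set_def \<theta>'_def)
    have "mat_root ?W *v (\<theta>' - \<theta>s) = ?\<eta> y"
      by (simp add: \<theta>'_def sym_posdef_matrix_inv_right[OF sym_posdef_mat_root[OF W]])
    then have "(norm (?\<eta> y))\<^sup>2 / 2 - ?lo y \<le> L y \<theta>' - L y \<theta>s"
      using lower[OF y \<theta>'] by simp
    also have "\<dots> \<le> L y (\<theta>t y) - L y \<theta>s" using max[OF y] \<theta>' sub by auto
    finally have "(norm (mat_root ?U *v (\<theta>t y - \<theta>s) - ?\<xi> y))\<^sup>2
        \<le> 2 * spread P \<Theta> L \<theta>s V2 D2 \<delta> \<rho> r y"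
      using upper[OF y loc] unfolding spread_def by argo
    then have "norm (mat_root ?U *v (\<theta>t y - \<theta>s) - ?\<xi> y)
        \<le> sqrt (2 * spread P \<Theta> L \<theta>s V2 D2 \<delta> \<rho> r y)"
      by (rule real_le_rsqrt)
    then show "norm (mat_root ?U *v (\<theta>t y - \<theta>s))
        \<le> norm (?\<xi> y) + sqrt (2 * spread P \<Theta> L \<theta>s V2 D2 \<delta> \<rho> r y)"
      using norm_triangle_sub[of "mat_root ?U *v (\<theta>t y - \<theta>s)" "?\<xi> y"] by linarith
  qed (use u in auto)

  show ?thesis
    using excess distance
    by (auto intro!: nn_integral_mono ennreal_leI split: split_indicator)
qed

end
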